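(* For all integers $m,n>0$, the $m$-Tamari lattice $\mathcal{T}_n^{(m)}$ is isomorphic to the Dedekind–MacNeille completion of the $m$-cover poset $\mathcal{T}_n^{\langle m\rangle}$ of the Tamari lattice $\mathcal{T}_n^{(1)}$.
   Context: For $m,n>0$, an $m$-Dyck path of length $(m+1)n$ is a lattice path from $(0,0)$ to $(mn,n)$ with north-steps $(0,1)$ and east-steps $(1,0)$ staying weakly above the line $x=my$; let $D_n^{(m)}$ be their set. Such a path is encoded by its step sequence $(u_1,\dots,u_n)$, where $u_k$ is the $x$-coordinate of the $k$-th north-step; these are exactly the sequences with $u_1\le\cdots\le u_n$ and $u_k\le m(k-1)$. For $i$, the primitive subsequence at position $i$ is $(u_i,\dots,u_k)$ where $k\ge i$ is the largest index such that $u_j-u_i<m(j-i)$ for all $j\in\{i+1,\dots,k\}$. Define $\mathfrak p\lessdot_{\mathrm{rot}}\mathfrak p'$ if the step sequence of $\mathfrak p'$ is $(u_1,\dots,u_{i-1},u_i-1,\dots,u_k-1,u_{k+1},\dots,u_n)$ for some $i\in\{2,\dots,n\}$ with $u_{i-1}<u_i$, where $(u_i,\dots,u_k)$ is the primitive subsequence of $\mathfrak p$'s step sequence at $i$. The rotation order $\le_{\mathrm{rot}}$ is the reflexive transitive closure, and $\mathcal{T}_n^{(m)}=(D_n^{(m)},\le_{\mathrm{rot}})$ is the $m$-Tamari lattice; $\mathcal T_n^{(1)}$ is the Tamari lattice. For a finite bounded poset $\mathcal P$ with least element $\hat0$ and $m>0$, the $m$-cover poset $\mathcal P^{\langle m\rangle}$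 is the subposet of the componentwise-ordered product $\mathcal P^m$ consisting of multichains $x_1\le\cdots\le x_m$ such that $\{x_1,\dots,x_m\}\setminus\{\hat0\}$ is empty, a singleton, or $\{p,q\}$ with $p\lessdot q$. $\mathcal T_n^{\langle m\rangle}$ denotes the $m$-cover poset of $\mathcal T_n^{(1)}$. The Dedekind–MacNeille completion of a poset $(P,\le)$ is the set of all $A\subseteq P$ with $A^{ul}=A$, ordered by inclusion, where $A^u=\{x: a\le x\ \forall a\in A\}$ and $A^l=\{x: x\le a\ \forall a\in A\}$; it is the smallest lattice containing the poset as a subposet. *)

theory Defs
  imports "HOL-Algebra.Lattice"
begin

section \<open>Dyck paths and the rotation order\<close>

datatype lattice_step = North | East

text \<open>
  A lattice path starting at the origin is the list of its steps; after its first \<open>k\<close> steps it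
  is at the point whose coordinates are the numbers of east-steps and of north-steps in
  \<open>take k p\<close>. As the region \<open>x \<le> m y\<close> is convex, it is enough to test these lattice points.
\<close>

definition dyck_paths :: "nat \<Rightarrow> nat \<Rightarrow> lattice_step list set" where
  "dyck_paths m n =
     {p. count_list p East = m * n \<and> count_list p North = n \<and>
         (\<forall>k\<le>length p. count_list (take k p) East \<le> m * count_list (take k p) North)}"

fun step_seq_from :: "nat \<Rightarrow> lattice_step list \<Rightarrow> nat list" where
  "step_seq_from x [] = []"
| "step_seq_from x (North # p) = x # step_seq_from x p"
| "step_seq_from x (East # p) = step_seq_from (x + 1) p"

definition step_seq :: "lattice_step list \<Rightarrow> nat list" where
  "step_seq p = step_seq_from 0 p"

text \<open>
  List positions count from 0, so the usual \<open>u\<^sub>i\<close> is \<open>u ! (i - 1)\<close>. The next function gives the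
  position of the last entry of the primitive subsequence that starts at position \<open>i\<close>. Step
  sequences are weakly increasing, so the subtraction \<open>u ! j - u ! i\<close> is never truncated on them.
\<close>

definition primitive_end :: "nat \<Rightarrow> nat list \<Rightarrow> nat \<Rightarrow> nat" where
  "primitive_end m u i =
     (GREATEST k. i \<le> k \<and> k < length u \<and> (\<forall>j\<in>{i<..k}. u ! j - u ! i < m * (j - i)))"

text \<open>
  The entries that are lowered are at least \<open>u ! i > u ! (i - 1) \<ge> 0\<close>, so \<open>u ! j - 1\<close> is not
  truncated either.
\<close>

definition rotation :: "nat \<Rightarrow> nat \<Rightarrow> lattice_step list \<Rightarrow> lattice_step list \<Rightarrow> bool" where
  "rotation m n p p' \<longleftrightarrow>
     p \<in> dyck_paths m n \<and> p' \<in> dyck_paths m n \<and>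
     (\<exists>i\<in>{1..<n}. step_seq p ! (i - 1) < step_seq p ! i \<and>
        step_seq p' =
          map (\<lambda>j. if i \<le> j \<and> j \<le> primitive_end m (step_seq p) i
                    then step_seq p ! j - 1 else step_seq p ! j) [0..<n])"

definition tamari :: "nat \<Rightarrow> nat \<Rightarrow> lattice_step list gorder" where
  "tamari m n = \<lparr>carrier = dyck_paths m n, eq = (=), le = (rotation m n)\<^sup>*\<^sup>*\<rparr>"


section \<open>The \<open>m\<close>-cover poset\<close>

definition covered_by :: "('a, 'b) gorder_scheme \<Rightarrow> 'a \<Rightarrow> 'a \<Rightarrow> bool" where
  "covered_by P p q \<longleftrightarrow>
     p \<in> carrier P \<and> q \<in> carrier P \<and> p \<sqsubset>\<^bsub>P\<^esub> q \<and>
     \<not> (\<exists>z\<in>carrier P. p \<sqsubset>\<^bsub>P\<^esub> z \<and> z \<sqsubset>\<^bsub>P\<^esub> q)"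

text \<open>
  Elements of \<open>P\<^sup>m\<close> are lists of length \<open>m\<close>. The definition is meant for a poset \<open>P\<close> that has a
  least element, which is then \<open>\<bottom>\<^bsub>P\<^esub>\<close>.
\<close>

definition cover_poset :: "nat \<Rightarrow> ('a, 'b) gorder_scheme \<Rightarrow> 'a list gorder" where
  "cover_poset m P =
     \<lparr>carrier = {xs. length xs = m \<and> set xs \<subseteq> carrier P \<and> sorted_wrt (\<sqsubseteq>\<^bsub>P\<^esub>) xs \<and>
         (set xs - {\<bottom>\<^bsub>P\<^esub>} = {} \<or>
          (\<exists>p. set xs - {\<bottom>\<^bsub>P\<^esub>} = {p}) \<or>
          (\<exists>p q. set xs - {\<bottom>\<^bsub>P\<^esub>} = {p, q} \<and> covered_by P p q))},
      eq = (=),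
      le = list_all2 (\<sqsubseteq>\<^bsub>P\<^esub>)\<rparr>"


section \<open>The Dedekind--MacNeille completion\<close>

definition macneille :: "('a, 'b) gorder_scheme \<Rightarrow> 'a set gorder" where
  "macneille P =
     \<lparr>carrier = {A. A \<subseteq> carrier P \<and> Lower P (Upper P A) = A}, eq = (=), le = (\<subseteq>)\<rparr>"

text \<open>\<^const>\<open>order_emb\<close> also requires both structures to be partial orders.\<close>

definition order_isomorphic :: "('a, 'c) gorder_scheme \<Rightarrow> ('b, 'd) gorder_scheme \<Rightarrow> bool" where
  "order_isomorphic P Q \<longleftrightarrow> (\<exists>f. order_emb P Q f \<and> bij_betw f (carrier P) (carrier Q))"

end

theory Submission
  imports Defs
begin

text \<open>
  Reading an \<open>m\<close>-Dyck path as a system of matched parentheses with \<open>m\<close> opening ones per north-step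
  encodes it by a bracket vector, and the rotation order becomes the pointwise order on bracket
  vectors. For \<open>r < m\<close>, the matching ends of the \<open>r\<close>-th parentheses form a bracket vector of the
  ordinary Tamari lattice, so the \<open>m\<close>-Tamari lattice is a set of multichains of length \<open>m\<close> in it,
  cut out by one compatibility condition. As a cover changes only one entry, all elements of the
  \<open>m\<close>-cover poset satisfy this condition. They are moreover join-dense and meet-dense, which
  characterises the Dedekind--MacNeille completion.
\<close>

section \<open>Heights and brackets\<close>

text \<open>The compatibility condition is the last clause of \<open>brackets\<close>: if position
  \<open>j\<close> lies inside a bracket of any layer \<open>r\<close>, then the outermost bracket
  at \<open>j\<close>, which is in layer 0, must end inside it too. This coupling of the layers
  decides three things. It guides the choice of a rotation that moves towards a given vector without
  overshooting it, the hard half of the order comparison. It survives pointwise infima, so that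
  every cut of the cover poset is given by a path. And it explains why such special multichains
  suffice. To separate \<open>y\<close> from \<open>x\<close> at entry \<open>i\<close> of layer
  \<open>s\<close> from below, only this entry has to be large, in the layers up to
  \<open>s\<close>, and all other layers can be least. From above, entry \<open>i\<close> is bounded
  only in the layers from \<open>s\<close> on, while the entries nested under it are bounded in all
  layers; the two vectors used then differ at \<open>i\<close> alone and form a cover.\<close>

definition heights :: "nat \<Rightarrow> nat \<Rightarrow> (nat \<Rightarrow> nat) \<Rightarrow> bool" where
  "heights m n h \<longleftrightarrow> h 0 = 0 \<and> (\<forall>i. Suc i < n \<longrightarrow> h (Suc i) \<le> h i + m)"

text \<open>
  Splitting each north-step into \<open>m\<close> up-steps, the \<open>r\<close>-th up-step at position \<open>i\<close> starts at level
  \<open>h i + r\<close>; \<open>bracket n h r i\<close> is the last position before its matching down-step.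
\<close>

definition bracket :: "nat \<Rightarrow> (nat \<Rightarrow> nat) \<Rightarrow> nat \<Rightarrow> nat \<Rightarrow> nat" where
  "bracket n h r i = (GREATEST k. i \<le> k \<and> k < n \<and> (\<forall>j\<in>{i<..k}. h i + r < h j))"

text \<open>For \<open>m = 1\<close> these are the classical bracket vectors of the Tamari lattice.
  The last clause mentions only \<open>x 0 j\<close> because the second makes it dominate
  \<open>x s j\<close> for all \<open>s < m\<close>.\<close>

definition brackets :: "nat \<Rightarrow> nat \<Rightarrow> (nat \<Rightarrow> nat \<Rightarrow> nat) \<Rightarrow> bool" where
  "brackets m n x \<longleftrightarrow>
     (\<forall>r<m. \<forall>i<n. i \<le> x r i \<and> x r i < n) \<and>
     (\<forall>r<m. \<forall>s\<le>r. \<forall>i<n. x r i \<le> x s i) \<and>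
     (\<forall>r<m. \<forall>i j. i < j \<longrightarrow> j < n \<longrightarrow> j \<le> x r i \<longrightarrow> x 0 j \<le> x r i)"

definition below :: "nat \<Rightarrow> nat \<Rightarrow> (nat \<Rightarrow> nat \<Rightarrow> nat) \<Rightarrow> (nat \<Rightarrow> nat \<Rightarrow> nat) \<Rightarrow> bool" where
  "below m n x y \<longleftrightarrow> (\<forall>r<m. \<forall>i<n. x r i \<le> y r i)"

lemma bracket_props:
  assumes "i < n"
  shows "i \<le> bracket n h r i \<and> bracket n h r i < n \<and>
    (\<forall>j\<in>{i<..bracket n h r i}. h i + r < h j)"
  unfolding bracket_def
  by (rule GreatestI_nat[where k = i and b = n]) (use assms in auto)

lemma le_bracket_iff:
  assumes "i \<le> k" "k < n"
  shows "k \<le> bracket n h r i \<longleftrightarrow> (\<forall>j\<in>{i<..k}. h i + r < h j)"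
proof
  assume "k \<le> bracket n h r i"
  with bracket_props[of i n h r] assms show "\<forall>j\<in>{i<..k}. h i + r < h j" by auto
next
  assume "\<forall>j\<in>{i<..k}. h i + r < h j"
  then show "k \<le> bracket n h r i"
    unfolding bracket_def
    by (intro Greatest_le_nat[where b = n]) (use assms in auto)
qed

lemma bracket_less: "i < n \<Longrightarrow> bracket n h r i < n"
  and bracket_ge: "i < n \<Longrightarrow> i \<le> bracket n h r i"
  and bracket_above: "i < j \<Longrightarrow> j \<le> bracket n h r i \<Longrightarrow> i < n \<Longrightarrow> h i + r < h j"
  using bracket_props[of i n h r] by auto

lemma bracket_stop:
  assumes "i < n" "Suc (bracket n h r i) < n"
  shows "h (Suc (bracket n h r i)) \<le> h i + r"
proof (rule ccontr)
  assume a: "\<not> ?thesis"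
  have "\<forall>j\<in>{i<..Suc (bracket n h r i)}. h i + r < h j"
  proof
    fix j assume "j \<in> {i<..Suc (bracket n h r i)}"
    then show "h i + r < h j"
      using bracket_above[of i j n h r] assms(1) a
      by (cases "j = Suc (bracket n h r i)") auto
  qed
  then have "Suc (bracket n h r i) \<le> bracket n h r i"
    by (subst le_bracket_iff) (use assms bracket_ge[of i n h r] in auto)
  then show False by simp
qed

text \<open>The admissible ends form an initial segment, so failure at \<open>Suc k\<close> is
  decisive.\<close>

lemma bracket_eqI:
  assumes "i \<le> k" "k < n" "\<And>j. i < j \<Longrightarrow> j \<le> k \<Longrightarrow> h i + r < h j"
    and "Suc k < n \<Longrightarrow> h (Suc k) \<le> h i + r"
  shows "bracket n h r i = k"
proof (rule antisym)
  show "k \<le> bracket n h r i" using assms by (subst le_bracket_iff) auto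
  show "bracket n h r i \<le> k"
  proof (rule ccontr)
    assume "\<not> ?thesis"
    then have "Suc k \<le> bracket n h r i" by simp
    moreover have "bracket n h r i < n" using assms bracket_less[of i n h r] by simp
    ultimately have "Suc k < n" "h i + r < h (Suc k)"
      using assms bracket_above[of i "Suc k" n h r] by auto
    then show False using assms(4) by simp
  qed
qed

text \<open>For the last clause: while the 0-th bracket at \<open>j\<close> is open the level stays
  above \<open>h j\<close>, which is itself above \<open>h i + r\<close>, so the bracket at
  \<open>i\<close> is open as well.\<close>

lemma brackets_bracket: "brackets m n (bracket n h)"
  unfolding brackets_def
proof (intro conjI allI impI)
  fix r i assume i: "i < n"
  show "i \<le> bracket n h r i" "bracket n h r i < n" using i by (auto intro: bracket_less bracket_ge)
  fix s assume "s \<le> r"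
  then show "bracket n h r i \<le> bracket n h s i"
    using bracket_props[of i n h r] i by (subst le_bracket_iff) fastforce+
next
  fix r i j assume a: "i < j" "j < n" "j \<le> bracket n h r i"
  have hj: "h i + r < h j" using a bracket_above[of i j n h r] by simp
  have "\<forall>k\<in>{i<..bracket n h 0 j}. h i + r < h k"
  proof
    fix k assume k: "k \<in> {i<..bracket n h 0 j}"
    show "h i + r < h k"
    proof (cases "k \<le> j")
      case True
      then show ?thesis using a k bracket_above[of i k n h r] by simp
    next
      case False
      then show ?thesis using a k hj bracket_above[of j k n h 0] by simp
    qed
  qed
  then show "bracket n h 0 j \<le> bracket n h r i"
    using a bracket_ge[of j n h 0] bracket_less[of j n h 0] by (subst le_bracket_iff) auto
qed

section \<open>Heights and bracket vectors determine each other\<close>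

text \<open>The last hypothesis says that a down-step directly precedes position \<open>i\<close>.
  It ends at level \<open>h i\<close>, so its partner starts at that level, at the last earlier
  position whose level is at most \<open>h i\<close>; position 0 shows that there is one.\<close>

lemma bracket_match:
  assumes "heights m n h" "i < n" "0 < i" "h i < h (i - 1) + m"
  obtains j r where "j < i" "r < m" "h j + r = h i" "\<forall>k. j < k \<longrightarrow> k < i \<longrightarrow> h i < h k"
    "bracket n h r j = i - 1"
proof -
  let ?P = "\<lambda>j. j < i \<and> h j \<le> h i"
  define j where "j = (GREATEST j. ?P j)"
  have j: "?P j" unfolding j_def
    by (rule GreatestI_nat[where k = 0 and b = i]) (use assms in \<open>auto simp: heights_def\<close>)
  have last: "h i < h k" if "j < k" "k < i" for k
  proof (rule ccontr)
    assume "\<not> h i < h k"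
    then have "k \<le> j" unfolding j_def by (intro Greatest_le_nat[where b = i]) (use that in auto)
    then show False using that by simp
  qed
  have lt: "h i < h j + m"
  proof (cases "j = i - 1")
    case True then show ?thesis using assms by simp
  next
    case False
    then have "Suc j < i" using j assms(3) by linarith
    then show ?thesis using last[of "Suc j"] assms by (auto simp: heights_def dest!: spec[of _ j])
  qed
  have "bracket n h (h i - h j) j = i - 1"
    using j assms last by (intro bracket_eqI) auto
  then show thesis using that[of j "h i - h j"] j lt last by auto
qed

text \<open>If \<open>i\<close> were the first difference and \<open>h i < h' i\<close>, the last
  down-step before \<open>i\<close> in \<open>h\<close> would close a bracket at
  \<open>i - 1\<close> which in \<open>h'\<close> is still open at \<open>i\<close>.\<close>

lemma bracket_inj_aux:
  assumes "heights m n h" "heights m n h'" "i < n"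
    and eq: "\<And>r i. r < m \<Longrightarrow> i < n \<Longrightarrow> bracket n h r i = bracket n h' r i"
    and prev: "\<And>k. k < i \<Longrightarrow> h k = h' k"
  shows "h' i \<le> h i"
proof (rule ccontr)
  assume less: "\<not> h' i \<le> h i"
  have i: "0 < i" using assms less by (cases i) (auto simp: heights_def)
  have "h' i \<le> h' (i - 1) + m" using assms(2) i \<open>i < n\<close> unfolding heights_def
    by (metis Suc_diff_1)
  then have "h i < h (i - 1) + m" using less prev[of "i - 1"] i by simp
  then obtain j r where jr: "j < i" "r < m" "h j + r = h i"
      "\<forall>k. j < k \<longrightarrow> k < i \<longrightarrow> h i < h k" "bracket n h r j = i - 1"
    using bracket_match[OF assms(1) \<open>i < n\<close> i] by blast
  have "i \<le> bracket n h' r j"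
  proof (subst le_bracket_iff)
    show "\<forall>k\<in>{j<..i}. h' j + r < h' k"
    proof
      fix k assume "k \<in> {j<..i}"
      then show "h' j + r < h' k"
        using jr(1,3) jr(4)[rule_format, of k] prev[of j] prev[of k] less by (cases "k = i") auto
    qed
  qed (use jr \<open>i < n\<close> in auto)
  then show False using eq[of r j] jr \<open>i < n\<close> i by simp
qed

lemma bracket_inj:
  assumes "heights m n h" "heights m n h'"
    and eq: "\<And>r i. r < m \<Longrightarrow> i < n \<Longrightarrow> bracket n h r i = bracket n h' r i"
    and "i < n"
  shows "h i = h' i"
  using \<open>i < n\<close>
proof (induction i rule: less_induct)
  case (less i)
  then have prev: "\<And>k. k < i \<Longrightarrow> h k = h' k" by simp
  show ?case
    using bracket_inj_aux[OF assms(1,2) less.prems eq prev]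
      bracket_inj_aux[OF assms(2,1) less.prems eq[symmetric] prev[symmetric]] by simp
qed

text \<open>
  The height at \<open>i\<close> is the number of up-steps before \<open>i\<close> that are still unmatched at \<open>i\<close>.
\<close>

lemma bracket_surj:
  assumes x: "brackets m n x"
  obtains h where "heights m n h" "\<And>r i. r < m \<Longrightarrow> i < n \<Longrightarrow> bracket n h r i = x r i"
proof -
  define S where "S i = {(j, r). j < i \<and> r < m \<and> i \<le> x r j}" for i
  define h where "h i = card (S i)" for i
  have fin: "finite (S i)" for i
    by (rule finite_subset[of _ "{..<i} \<times> {..<m}"]) (auto simp: S_def)
  have x1: "i \<le> x r i" "x r i < n" if "r < m" "i < n" for r i
    using x that unfolding brackets_def by auto
  have x2: "x r i \<le> x s i" if "s \<le> r" "r < m" "i < n" for r s i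
    using x that unfolding brackets_def by auto
  have x3: "x 0 j \<le> x r i" if "i < j" "j < n" "j \<le> x r i" "r < m" for r i j
    using x that unfolding brackets_def by auto
  have "heights m n h"
    unfolding heights_def
  proof (intro conjI allI impI)
    show "h 0 = 0" by (simp add: h_def S_def)
    fix i assume "Suc i < n"
    have "S (Suc i) \<subseteq> S i \<union> {i} \<times> {..<m}" by (auto simp: S_def)
    then have "h (Suc i) \<le> card (S i \<union> {i} \<times> {..<m})"
      unfolding h_def by (rule card_mono[rotated]) (simp add: fin)
    also have "\<dots> \<le> h i + card ({i} \<times> {..<m})" unfolding h_def by (rule card_Un_le)
    finally show "h (Suc i) \<le> h i + m" by (simp add: card_cartesian_product)
  qed
  moreover have "bracket n h r i = x r i" if r: "r < m" and i: "i < n" for r i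
  proof (rule bracket_eqI)
    show "i \<le> x r i" "x r i < n" using x1 r i by auto
  next
    fix k assume k: "i < k" "k \<le> x r i"
    \<comment> \<open>What is open at \<open>i\<close> stays open up to \<open>x r i\<close>:
      compatibility gives \<open>x s j \<ge> x 0 i \<ge> x r i\<close>.\<close>
    have "S i \<union> {i} \<times> {..r} \<subseteq> S k"
    proof
      fix a assume "a \<in> S i \<union> {i} \<times> {..r}"
      then consider j s where "a = (j, s)" "j < i" "s < m" "i \<le> x s j"
        | s where "a = (i, s)" "s \<le> r"
        by (auto simp: S_def)
      then show "a \<in> S k"
      proof cases
        case 1
        then have "x r i \<le> x s j" using x3[of j i s] x2[of 0 r i] r i by simp
        then show ?thesis using 1 k by (simp add: S_def)
      next
        case 2
        then show ?thesis using x2[of s r i] r i k by (simp add: S_def)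
      qed
    qed
    then have "card (S i \<union> {i} \<times> {..r}) \<le> h k" unfolding h_def by (rule card_mono[OF fin])
    moreover have "card (S i \<union> {i} \<times> {..r}) = h i + card ({i} \<times> {..r})"
      unfolding h_def by (rule card_Un_disjoint) (auto simp: fin, auto simp: S_def)
    ultimately show "h i + r < h k" by (simp add: card_cartesian_product)
  next
    assume k: "Suc (x r i) < n"
    \<comment> \<open>Up-steps from positions strictly between are closed by then, again by
      compatibility, and of those at \<open>i\<close> only the layers below \<open>r\<close> can
      remain.\<close>
    have "S (Suc (x r i)) \<subseteq> S i \<union> {i} \<times> {..<r}"
    proof
      fix a assume "a \<in> S (Suc (x r i))"
      then obtain j s where a: "a = (j, s)" "j < Suc (x r i)" "s < m" "Suc (x r i) \<le> x s j"
        by (auto simp: S_def)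
      consider "j < i" | "j = i" | "i < j" by linarith
      then show "a \<in> S i \<union> {i} \<times> {..<r}"
      proof cases
        case 1
        then show ?thesis using a x1[OF r i] by (simp add: S_def)
      next
        case 2
        then show ?thesis using a x2[of r s i] i by (cases "s < r") auto
      next
        case 3
        then have "x 0 j \<le> x r i" using x3[of i j r] a k r by simp
        then show ?thesis using a x2[of 0 s j] k by simp
      qed
    qed
    then have "h (Suc (x r i)) \<le> card (S i \<union> {i} \<times> {..<r})"
      unfolding h_def by (rule card_mono[rotated]) (simp add: fin)
    also have "\<dots> \<le> h i + card ({i} \<times> {..<r})" unfolding h_def by (rule card_Un_le)
    finally show "h (Suc (x r i)) \<le> h i + r" by (simp add: card_cartesian_product)
  qed
  ultimately show thesis by (rule that)
qed

section \<open>Rotations acting on heights\<close>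

text \<open>Lowering a step sequence by one on a primitive subsequence raises the levels there by
  one; the subsequence ends where the 0-th bracket at \<open>i\<close> does.\<close>

definition raise :: "nat \<Rightarrow> (nat \<Rightarrow> nat) \<Rightarrow> nat \<Rightarrow> nat \<Rightarrow> nat" where
  "raise n h i j = (if i \<le> j \<and> j \<le> bracket n h 0 i then Suc (h j) else h j)"

text \<open>The only rise that grows is the one entering \<open>i\<close>, where the last hypothesis
  leaves room.\<close>

lemma heights_raise:
  assumes "heights m n h" "i < n" "0 < i" "h i < h (i - 1) + m"
  shows "heights m n (raise n h i)"
  unfolding heights_def
proof (intro conjI allI impI)
  show "raise n h i 0 = 0" using assms by (simp add: raise_def heights_def)
  fix j assume j: "Suc j < n"
  have step: "h (Suc j) \<le> h j + m" using assms j by (simp add: heights_def)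
  show "raise n h i (Suc j) \<le> raise n h i j + m"
    using step assms(3,4) by (cases "i = Suc j") (auto simp: raise_def)
qed

text \<open>
  A rotation moves a single down-step, the partner of the unique up-step that starts at the level
  of position \<open>i\<close> and is matched just before \<open>i\<close>.
\<close>

lemma bracket_raise:
  assumes "heights m n h" "i < n" "0 < i" "h i < h (i - 1) + m"
  obtains j r where "j < i" "r < m" "h j + r = h i" "\<forall>k. j < k \<longrightarrow> k < i \<longrightarrow> h i < h k"
    "bracket n h r j = i - 1" "bracket n (raise n h i) r j = bracket n h 0 i"
    "\<forall>s k. k < n \<longrightarrow> (s, k) \<noteq> (r, j) \<longrightarrow> bracket n (raise n h i) s k = bracket n h s k"
proof -
  let ?e = "bracket n h 0 i" and ?g = "raise n h i"
  obtain j r where jr: "j < i" "r < m" "h j + r = h i" "\<forall>k. j < k \<longrightarrow> k < i \<longrightarrow> h i < h k"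
      "bracket n h r j = i - 1"
    using bracket_match[OF assms] by blast
  have e: "i \<le> ?e" "?e < n" using bracket_ge bracket_less assms by auto
  have above: "h i < h k" if "i < k" "k \<le> ?e" for k
    using bracket_above[of i k n h 0] that assms by simp
  have stop: "Suc ?e < n \<Longrightarrow> h (Suc ?e) \<le> h i" using bracket_stop[of i n h 0] assms by simp
  have new: "bracket n ?g r j = ?e"
  proof (rule bracket_eqI)
    fix k assume k: "j < k" "k \<le> ?e"
    then show "?g j + r < ?g k" using jr above[of k]
      by (cases k i rule: linorder_cases) (auto simp: raise_def)
  qed (use jr e stop in \<open>auto simp: raise_def\<close>)
  have same: "bracket n ?g s k = bracket n h s k" if k: "k < n" and ne: "(s, k) \<noteq> (r, j)" for s k
  proof (rule bracket_eqI)
    let ?b = "bracket n h s k"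
    show b: "k \<le> ?b" "?b < n" using bracket_ge bracket_less k by auto
    show "?g k + s < ?g l" if l: "k < l" "l \<le> ?b" for l
    proof -
      have hl: "h k + s < h l" using l k by (rule bracket_above)
      \<comment> \<open>A bracket opened in the raised block closes within it, because the level
        right after the block is at most \<open>h i\<close>. Both sides are then raised
        together.\<close>
      have "l \<le> ?e" if "i \<le> k" "k \<le> ?e"
      proof (rule ccontr)
        assume "\<not> l \<le> ?e"
        then have "h k + s < h (Suc ?e)" "Suc ?e < n"
          using l that b bracket_above[of k "Suc ?e" n h s] k by auto
        then show False using stop above[of k] that by (cases "k = i") auto
      qed
      then show ?thesis using hl l by (auto simp: raise_def)
    qed
    show "?g (Suc ?b) \<le> ?g k + s" if sb: "Suc ?b < n"
    proof -
      have hb: "h (Suc ?b) \<le> h k + s" using bracket_stop k sb by blast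
      \<comment> \<open>The danger is that \<open>Suc ?b\<close> is raised and \<open>k\<close> is
        not. A bracket spanning \<open>i\<close> does not end before the block does. One ending at
        \<open>i - 1\<close> must start strictly above level \<open>h i\<close>, since equality
        would make it the moved bracket \<open>(r, j)\<close>.\<close>
      consider "i \<le> k" | "k < i" "?b < i - 1" | "k < i" "i \<le> ?b" | "k < i" "?b = i - 1" by linarith
      then show ?thesis
      proof cases
        case 1
        then show ?thesis using hb b by (auto simp: raise_def)
      next
        case 2
        then show ?thesis using hb by (auto simp: raise_def)
      next
        case 3
        have "h k + s < h i" using 3 bracket_above[of k i n h s] k by simp
        then have "\<not> Suc ?b \<le> ?e" using hb above[of "Suc ?b"] 3 by auto
        then show ?thesis using hb 3 by (simp add: raise_def)
      next
        case 4
        then have si: "Suc ?b = i" using assms by simp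
        have "h i \<noteq> h k + s"
        proof
          assume eq: "h i = h k + s"
          consider "k < j" | "j < k" | "k = j" by linarith
          then show False
          proof cases
            case 1
            then have "h k + s < h j" using bracket_above[of k j n h s] jr k 4 by simp
            then show ?thesis using eq jr by simp
          next
            case 2
            then show ?thesis using jr(4)[rule_format, of k] eq 4 by simp
          next
            case 3
            then show ?thesis using eq jr ne by simp
          qed
        qed
        then show ?thesis using hb si 4 e by (simp add: raise_def)
      qed
    qed
  qed
  from same have "\<forall>s k. k < n \<longrightarrow> (s, k) \<noteq> (r, j) \<longrightarrow> bracket n ?g s k = bracket n h s k"
    by (intro allI impI) (rule same)
  with jr new show thesis by (rule that)
qed

lemma below_raise:
  assumes "heights m n h" "i < n" "0 < i" "h i < h (i - 1) + m"
  shows "below m n (bracket n h) (bracket n (raise n h i))"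
proof -
  obtain j r where jr: "j < i" "r < m" "h j + r = h i" "\<forall>k. j < k \<longrightarrow> k < i \<longrightarrow> h i < h k"
    "bracket n h r j = i - 1" "bracket n (raise n h i) r j = bracket n h 0 i"
    "\<forall>s k. k < n \<longrightarrow> (s, k) \<noteq> (r, j) \<longrightarrow> bracket n (raise n h i) s k = bracket n h s k"
    by (rule bracket_raise[OF assms])
  have "i - 1 \<le> bracket n h 0 i" using bracket_ge[of i n h 0] assms by simp
  then have "bracket n h s k \<le> bracket n (raise n h i) s k" if "k < n" for s k
    using jr(5,6) jr(7)[rule_format, of k s] that by (cases "(s, k) = (r, j)") auto
  then show ?thesis by (simp add: below_def)
qed

text \<open>Rotate at the position \<open>i\<close> right after the bracket that is too short. The
  bracket \<open>(r', j')\<close> extended by this is \<open>(r, j)\<close> or encloses it, so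
  \<open>y r' j'\<close> reaches \<open>i\<close>; compatibility of \<open>y\<close> then yields
  \<open>y 0 i \<le> y r' j'\<close>, and the new end \<open>bracket n h 0 i\<close> is at most
  \<open>y 0 i\<close> by assumption.\<close>

lemma exists_raise_below:
  assumes h: "heights m n h" and y: "brackets m n y" and le: "below m n (bracket n h) y"
    and less: "r < m" "j < n" "bracket n h r j < y r j"
  obtains i where "i < n" "0 < i" "h i < h (i - 1) + m" "below m n (bracket n (raise n h i)) y"
proof -
  define i where "i = Suc (bracket n h r j)"
  have y1: "\<And>r i. r < m \<Longrightarrow> i < n \<Longrightarrow> y r i < n"
    and y2: "\<And>r s i. s \<le> r \<Longrightarrow> r < m \<Longrightarrow> i < n \<Longrightarrow> y r i \<le> y s i"
    and y3: "\<And>r i j. i < j \<Longrightarrow> j < n \<Longrightarrow> j \<le> y r i \<Longrightarrow> r < m \<Longrightarrow> y 0 j \<le> y r i"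
    using y unfolding brackets_def by auto
  have i: "i < n" "0 < i" "i \<le> y r j" "j < i"
    using less y1[of r j] bracket_ge[of j n h r] by (auto simp: i_def)
  have hi: "h i \<le> h j + r" using bracket_stop[of j n h r] less i by (simp add: i_def)
  have hk: "h j + r < h k" if "j < k" "k < i" for k
    using bracket_above[of j k n h r] that less by (simp add: i_def)
  have up: "h i < h (i - 1) + m"
  proof (cases "j = i - 1")
    case True
    then show ?thesis using hi less by simp
  next
    case False
    then have "j < i - 1" using i by linarith
    then show ?thesis using hi hk[of "i - 1"] i by simp
  qed
  obtain j' r' where jr: "j' < i" "r' < m" "h j' + r' = h i" "\<forall>k. j' < k \<longrightarrow> k < i \<longrightarrow> h i < h k"
    "bracket n h r' j' = i - 1" "bracket n (raise n h i) r' j' = bracket n h 0 i"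
    "\<forall>s k. k < n \<longrightarrow> (s, k) \<noteq> (r', j') \<longrightarrow> bracket n (raise n h i) s k = bracket n h s k"
    by (rule bracket_raise[OF h i(1,2) up])
  have "i \<le> y r' j'"
  proof (cases "j' = j")
    case True
    then have "r' \<le> r" using hi jr by simp
    then show ?thesis using y2[of r' r j] less i True by simp
  next
    case False
    \<comment> \<open>For \<open>j < j' < i\<close> the level \<open>h j'\<close> would exceed
      \<open>h j + r\<close>, hence also \<open>h i = h j' + r'\<close>.\<close>
    then have "j' < j" using hk[of j'] hi jr(1,3) by (cases j j' rule: linorder_cases) auto
    moreover have "bracket n h r' j' \<le> y r' j'" using le jr(1,2) i by (simp add: below_def)
    then have "j \<le> y r' j'" using jr(5) i by linarith
    ultimately have "y 0 j \<le> y r' j'" using y3 jr(2) less by simp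
    then show ?thesis using y2[of 0 r j] less i by simp
  qed
  then have "y 0 i \<le> y r' j'" using y3[of j' i r'] jr(1,2) i by simp
  moreover have "bracket n h 0 i \<le> y 0 i" using le i less by (simp add: below_def)
  ultimately have new: "bracket n (raise n h i) r' j' \<le> y r' j'" using jr(6) by simp
  have "bracket n (raise n h i) s k \<le> y s k" if "s < m" "k < n" for s k
    using new jr(7)[rule_format, of k s] le that by (cases "(s, k) = (r', j')")
      (auto simp: below_def)
  then show thesis using that i up by (simp add: below_def)
qed

section \<open>The rotation order in terms of bracket vectors\<close>

lemma length_step_seq_from: "length (step_seq_from x p) = count_list p North"
  by (induction x p rule: step_seq_from.induct) auto

lemma step_seq_from_ge: "a \<in> set (step_seq_from x p) \<Longrightarrow> x \<le> a"
  by (induction x p rule: step_seq_from.induct) auto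

lemma sorted_step_seq_from: "sorted (step_seq_from x p)"
  by (induction x p rule: step_seq_from.induct) (auto dest: step_seq_from_ge)

text \<open>The step sequence forgets the east-steps after the last north-step; the total number of
  east-steps restores them.\<close>

lemma step_seq_from_inj:
  "step_seq_from x p = step_seq_from x q \<Longrightarrow> count_list p East = count_list q East \<Longrightarrow> p = q"
proof (induction x p arbitrary: q rule: step_seq_from.induct)
  case (1 x)
  then show ?case
  proof (cases q)
    case (Cons s q')
    then show ?thesis using 1 length_step_seq_from[of x q]
      by (cases s) (auto simp: length_step_seq_from[symmetric])
  qed simp
next
  case (2 x p)
  show ?case
  proof (cases q)
    case Nil
    then show ?thesis using 2 by simp
  next
    case (Cons s q')
    then show ?thesis
      using 2 step_seq_from_ge[of x "x + 1" q'] by (cases s) (auto dest: sym)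
  qed
next
  case (3 x p)
  show ?case
  proof (cases q)
    case Nil
    then show ?thesis using 3 by simp
  next
    case (Cons s q')
    then show ?thesis using 3 step_seq_from_ge[of x "x + 1" p] by (cases s) auto
  qed
qed

text \<open>Between north-steps the abscissa only grows, so the bound is tightest just before each
  north-step and at the end. The starting point \<open>(x, y)\<close> is kept general for the
  induction.\<close>

lemma step_seq_from_less_iff:
  "(\<forall>k\<le>length p. x + count_list (take k p) East \<le> m * (y + count_list (take k p) North)) \<longleftrightarrow>
   x + count_list p East \<le> m * (y + count_list p North) \<and>
   (\<forall>k<count_list p North. step_seq_from x p ! k \<le> m * (y + k))" (is "?L x y p \<longleftrightarrow> ?R x y p")
proof (induction p arbitrary: x y)
  case Nil
  then show ?case by simp
next
  case (Cons s p)
  have split: "(\<forall>k\<le>length (s # p). P k) \<longleftrightarrow> P 0 \<and> (\<forall>k\<le>length p. P (Suc k))" for P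
    by (metis length_Cons Suc_le_mono le0 not0_implies_Suc)
  have zero: "?L x y p \<Longrightarrow> x \<le> m * y" for x y by (auto dest: spec[of _ 0])
  show ?case
  proof (cases s)
    case North
    have "?L x y (s # p) \<longleftrightarrow> x \<le> m * y \<and> ?L x (Suc y) p"
      unfolding split by (simp add: North)
    also have "\<dots> \<longleftrightarrow> x \<le> m * y \<and> ?R x (Suc y) p" using Cons.IH by blast
    also have "\<dots> \<longleftrightarrow> ?R x y (s # p)"
      by (auto simp: North nth_Cons split: nat.splits)
    finally show ?thesis .
  next
    case East
    have "?L x y (s # p) \<longleftrightarrow> x \<le> m * y \<and> ?L (Suc x) y p"
      unfolding split by (simp add: East)
    also have "\<dots> \<longleftrightarrow> ?L (Suc x) y p" using zero[of "Suc x" y] by auto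
    also have "\<dots> \<longleftrightarrow> ?R (Suc x) y p" using Cons.IH by blast
    also have "\<dots> \<longleftrightarrow> ?R x y (s # p)" by (simp add: East)
    finally show ?thesis .
  qed
qed

lemma dyck_paths_iff:
  "p \<in> dyck_paths m n \<longleftrightarrow>
     count_list p East = m * n \<and> count_list p North = n \<and> (\<forall>k<n. step_seq p ! k \<le> m * k)"
  using step_seq_from_less_iff[of p 0 m 0] by (auto simp: dyck_paths_def step_seq_def)

lemma length_step_seq: "p \<in> dyck_paths m n \<Longrightarrow> length (step_seq p) = n"
  by (simp add: dyck_paths_iff step_seq_def length_step_seq_from)

lemma sorted_step_seq: "sorted (step_seq p)"
  by (simp add: step_seq_def sorted_step_seq_from)

text \<open>A right inverse of \<open>step_seq_from x\<close> on sorted input; \<open>N\<close> is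
  the final abscissa. The subtractions are exact on sorted lists with entries between
  \<open>x\<close> and \<open>N\<close>.\<close>

fun path_from :: "nat \<Rightarrow> nat \<Rightarrow> nat list \<Rightarrow> lattice_step list" where
  "path_from N x [] = replicate (N - x) East"
| "path_from N x (a # u) = replicate (a - x) East @ North # path_from N a u"

lemma step_seq_from_replicate: "step_seq_from x (replicate c East @ p) = step_seq_from (x + c) p"
  by (induction c arbitrary: x) auto

lemma step_seq_from_path_from:
  assumes "sorted (x # u)"
  shows "step_seq_from x (path_from N x u) = u"
  using assms
proof (induction u arbitrary: x)
  case Nil
  show ?case using step_seq_from_replicate[of x "N - x" "[]"] by simp
next
  case (Cons a u)
  then show ?case by (simp add: step_seq_from_replicate)
qed

lemma count_list_replicate: "count_list (replicate c a) b = (if a = b then c else 0)"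
  by (induction c) auto

lemma count_path_from:
  assumes "sorted (x # u)" "\<forall>a\<in>set (x # u). a \<le> N"
  shows "count_list (path_from N x u) East = N - x \<and> count_list (path_from N x u) North = length u"
  using assms
  by (induction u arbitrary: x) (auto simp: count_list_replicate)

lemma exists_dyck_path:
  assumes "length u = n" "sorted u" "\<forall>k<n. u ! k \<le> m * k"
  obtains p where "p \<in> dyck_paths m n" "step_seq p = u"
proof
  let ?p = "path_from (m * n) 0 u"
  show s: "step_seq ?p = u" unfolding step_seq_def
    by (rule step_seq_from_path_from) (use assms in simp)
  have "a \<le> m * n" if "a \<in> set u" for a
    using that assms by (metis in_set_conv_nth less_imp_le_nat mult_le_mono2 le_trans)
  then show "?p \<in> dyck_paths m n"
    using count_path_from[of 0 u "m * n"] assms s by (simp add: dyck_paths_iff)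
qed

lemma step_seq_inj:
  "p \<in> dyck_paths m n \<Longrightarrow> q \<in> dyck_paths m n \<Longrightarrow> step_seq p = step_seq q \<Longrightarrow> p = q"
  unfolding dyck_paths_iff step_seq_def by (metis step_seq_from_inj)

section \<open>Heights of Dyck paths\<close>

text \<open>The level before the north-step at position \<open>i\<close>, with \<open>m\<close>
  up-steps for each north-step and a down-step for each east-step. The Dyck condition makes the
  subtraction exact.\<close>

definition height :: "nat \<Rightarrow> lattice_step list \<Rightarrow> nat \<Rightarrow> nat" where
  "height m p i = m * i - step_seq p ! i"

lemma step_seq_conv_height:
  "p \<in> dyck_paths m n \<Longrightarrow> i < n \<Longrightarrow> step_seq p ! i + height m p i = m * i"
  by (simp add: dyck_paths_iff height_def)

lemma step_seq_mono:
  "p \<in> dyck_paths m n \<Longrightarrow> i \<le> j \<Longrightarrow> j < n \<Longrightarrow> step_seq p ! i \<le> step_seq p ! j"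
  using sorted_step_seq[of p] length_step_seq[of p m n] by (simp add: sorted_iff_nth_mono)

lemma heights_height:
  assumes "p \<in> dyck_paths m n" "0 < n"
  shows "heights m n (height m p)"
  unfolding heights_def
proof (intro conjI allI impI)
  show "height m p 0 = 0" by (simp add: height_def)
  fix i assume "Suc i < n"
  then show "height m p (Suc i) \<le> height m p i + m"
    using step_seq_conv_height[OF assms(1), of i] step_seq_conv_height[OF assms(1), of "Suc i"]
      step_seq_mono[OF assms(1), of i "Suc i"] by simp
qed

lemma height_inj:
  assumes "p \<in> dyck_paths m n" "q \<in> dyck_paths m n" "\<And>i. i < n \<Longrightarrow> height m p i = height m q i"
  shows "p = q"
proof (rule step_seq_inj[OF assms(1,2)], rule nth_equalityI)
  show "length (step_seq p) = length (step_seq q)" using assms length_step_seq by metis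
  fix i assume "i < length (step_seq p)"
  then show "step_seq p ! i = step_seq q ! i"
    using assms(3)[of i] step_seq_conv_height[OF assms(1), of i]
      step_seq_conv_height[OF assms(2), of i] length_step_seq[OF assms(1)] by simp
qed

text \<open>The bound on the rises makes \<open>m * i - h i\<close> weakly increasing and,
  accumulated from \<open>h 0 = 0\<close>, gives \<open>h i \<le> m * i\<close>, so no subtraction
  is truncated.\<close>

lemma height_surj:
  assumes "heights m n h"
  obtains p where "p \<in> dyck_paths m n" "\<And>i. i < n \<Longrightarrow> height m p i = h i"
proof -
  have step: "h (Suc i) \<le> h i + m" if "Suc i < n" for i
    using assms that by (simp add: heights_def)
  have le: "h i \<le> m * i" if "i < n" for i
    using that
  proof (induction i)
    case 0
    then show ?case using assms by (simp add: heights_def)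
  next
    case (Suc i)
    then show ?case using step[of i] by simp
  qed
  let ?u = "map (\<lambda>i. m * i - h i) [0..<n]"
  have "sorted ?u"
  proof (subst sorted_iff_nth_Suc, intro allI impI)
    fix i assume "Suc i < length ?u"
    then show "?u ! i \<le> ?u ! Suc i" using step[of i] le[of i] by simp
  qed
  then obtain p where p: "p \<in> dyck_paths m n" "step_seq p = ?u"
    by (rule exists_dyck_path[of ?u n m, rotated]) auto
  then have "height m p i = h i" if "i < n" for i
    using that le[of i] by (simp add: height_def)
  with p(1) show thesis by (rule that)
qed

text \<open>In terms of levels, \<open>u ! j - u ! i < m * (j - i)\<close> reads
  \<open>h i < h j\<close>.\<close>

lemma primitive_end_eq:
  assumes "p \<in> dyck_paths m n" "i < n"
  shows "primitive_end m (step_seq p) i = bracket n (height m p) 0 i"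
proof -
  have "step_seq p ! j - step_seq p ! i < m * (j - i) \<longleftrightarrow> height m p i < height m p j"
    if "i < j" "j < n" for j
  proof -
    have "m * j = m * i + m * (j - i)" using that by (simp flip: distrib_left)
    then show ?thesis
      using step_seq_conv_height[OF assms] step_seq_conv_height[OF assms(1), of j]
        step_seq_mono[OF assms(1), of i j] that by linarith
  qed
  then have "(i \<le> k \<and> k < length (step_seq p) \<and>
        (\<forall>j\<in>{i<..k}. step_seq p ! j - step_seq p ! i < m * (j - i))) \<longleftrightarrow>
      (i \<le> k \<and> k < n \<and> (\<forall>j\<in>{i<..k}. height m p i + 0 < height m p j))" for k
    using length_step_seq[OF assms(1)] by auto
  then show ?thesis unfolding primitive_end_def bracket_def by presburger
qed

lemma rotation_iff:
  assumes p: "p \<in> dyck_paths m n" and q: "q \<in> dyck_paths m n"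
  shows "rotation m n p q \<longleftrightarrow>
    (\<exists>i\<in>{1..<n}. height m p i < height m p (i - 1) + m \<and>
       (\<forall>j<n. height m q j = raise n (height m p) i j))"
proof -
  have *: "(step_seq p ! (i - 1) < step_seq p ! i \<and>
      step_seq q = map (\<lambda>j. if i \<le> j \<and> j \<le> primitive_end m (step_seq p) i
        then step_seq p ! j - 1 else step_seq p ! j) [0..<n]) \<longleftrightarrow>
    (height m p i < height m p (i - 1) + m \<and> (\<forall>j<n. height m q j = raise n (height m p) i j))"
    (is "?A1 \<and> ?A2 \<longleftrightarrow> ?B1 \<and> ?B2")
    if i: "i \<in> {1..<n}" for i
  proof -
    have "m * i = m * (i - 1) + m" using i by (cases i) auto
    moreover have "i < n" "i - 1 < n" using i by auto
    ultimately have 1: "?A1 \<longleftrightarrow> ?B1"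
      using step_seq_conv_height[OF p, of i] step_seq_conv_height[OF p, of "i - 1"] by linarith
    \<comment> \<open>\<open>?A1\<close> keeps the lowered entries positive, so that their
      \<open>- 1\<close> is a genuine decrement.\<close>
    have 2: "?A2 \<longleftrightarrow> ?B2" if A: ?A1
    proof -
      have "?A2 \<longleftrightarrow> (\<forall>j<n. step_seq q ! j = (if i \<le> j \<and> j \<le> primitive_end m (step_seq p) i
        then step_seq p ! j - 1 else step_seq p ! j))"
        using length_step_seq[OF q] by (simp add: list_eq_iff_nth_eq)
      also have "\<dots> \<longleftrightarrow> ?B2"
      proof (intro all_cong)
        fix j assume j: "j < n"
        have "0 < step_seq p ! j" if "i \<le> j" using A step_seq_mono[OF p that j] by simp
        then show "(step_seq q ! j = (if i \<le> j \<and> j \<le> primitive_end m (step_seq p) i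
            then step_seq p ! j - 1 else step_seq p ! j)) \<longleftrightarrow>
          height m q j = raise n (height m p) i j"
          using step_seq_conv_height[OF p j] step_seq_conv_height[OF q j] i
          by (auto simp: raise_def primitive_end_eq[OF p])
      qed
      finally show ?thesis .
    qed
    show ?thesis using 1 2 by blast
  qed
  show ?thesis by (simp only: rotation_def p q simp_thms) (rule bex_cong[OF refl *])
qed

section \<open>Bracket vectors of Dyck paths\<close>

definition bvec :: "nat \<Rightarrow> nat \<Rightarrow> lattice_step list \<Rightarrow> nat \<Rightarrow> nat \<Rightarrow> nat" where
  "bvec m n p = bracket n (height m p)"

lemma brackets_bvec: "brackets m n (bvec m n p)"
  unfolding bvec_def by (rule brackets_bracket)

lemma bvec_inj:
  assumes "p \<in> dyck_paths m n" "q \<in> dyck_paths m n"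
    and "\<And>r i. r < m \<Longrightarrow> i < n \<Longrightarrow> bvec m n p r i = bvec m n q r i"
  shows "p = q"
proof (rule height_inj[OF assms(1,2)])
  fix i assume "i < n"
  then show "height m p i = height m q i"
    using bracket_inj[OF heights_height[OF assms(1)] heights_height[OF assms(2)]] assms(3)
    unfolding bvec_def by fastforce
qed

lemma bracket_cong:
  assumes "\<And>k. k < n \<Longrightarrow> h k = h' k" "i < n"
  shows "bracket n h r i = bracket n h' r i"
proof -
  have "(i \<le> k \<and> k < n \<and> (\<forall>j\<in>{i<..k}. h i + r < h j)) \<longleftrightarrow>
      (i \<le> k \<and> k < n \<and> (\<forall>j\<in>{i<..k}. h' i + r < h' j))" for k
    using assms by auto
  then show ?thesis unfolding bracket_def by presburger
qed

lemma bvec_surj: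
  assumes "brackets m n x"
  obtains p where "p \<in> dyck_paths m n" "\<And>r i. r < m \<Longrightarrow> i < n \<Longrightarrow> bvec m n p r i = x r i"
proof -
  obtain h where h: "heights m n h" "\<And>r i. r < m \<Longrightarrow> i < n \<Longrightarrow> bracket n h r i = x r i"
    using bracket_surj[OF assms] by blast
  obtain p where p: "p \<in> dyck_paths m n" "\<And>i. i < n \<Longrightarrow> height m p i = h i"
    using height_surj[OF h(1)] by blast
  have "bvec m n p r i = x r i" if "r < m" "i < n" for r i
    unfolding bvec_def using bracket_cong[of n "height m p" h i r] p(2) h(2) that by simp
  with p(1) show thesis by (rule that)
qed

lemma below_refl: "below m n x x"
  by (simp add: below_def)

lemma below_trans: "below m n x y \<Longrightarrow> below m n y z \<Longrightarrow> below m n x z"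
  unfolding below_def by (meson le_trans)

lemma below_bvec_antisym:
  assumes "p \<in> dyck_paths m n" "q \<in> dyck_paths m n"
    and "below m n (bvec m n p) (bvec m n q)" "below m n (bvec m n q) (bvec m n p)"
  shows "p = q"
  using assms by (intro bvec_inj[of p m n q]) (auto simp: below_def intro: antisym)

text \<open>Which entry moves is left open: later only the locality of the change and its direction
  matter.\<close>

lemma rotation_bvec:
  assumes "rotation m n p q"
  obtains j r where "r < m" "j < n"
    "\<And>s k. k < n \<Longrightarrow> (s, k) \<noteq> (r, j) \<Longrightarrow> bvec m n q s k = bvec m n p s k"
    "below m n (bvec m n p) (bvec m n q)"
proof -
  have p: "p \<in> dyck_paths m n" and q: "q \<in> dyck_paths m n" using assms by (auto simp: rotation_def)
  obtain i where i: "i < n" "0 < i" "height m p i < height m p (i - 1) + m"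
      "\<And>j. j < n \<Longrightarrow> height m q j = raise n (height m p) i j"
    using assms unfolding rotation_iff[OF p q] by auto
  have h: "heights m n (height m p)" using heights_height[OF p] i by simp
  have eq: "bvec m n q s k = bracket n (raise n (height m p) i) s k" if "k < n" for s k
    unfolding bvec_def using i(4) that by (intro bracket_cong)
  obtain j r where jr: "j < i" "r < m"
    and "height m p j + r = height m p i"
      "\<forall>k. j < k \<longrightarrow> k < i \<longrightarrow> height m p i < height m p k"
      "bracket n (height m p) r j = i - 1"
      "bracket n (raise n (height m p) i) r j = bracket n (height m p) 0 i"
    and same: "\<forall>s k. k < n \<longrightarrow> (s, k) \<noteq> (r, j) \<longrightarrow>
      bracket n (raise n (height m p) i) s k = bracket n (height m p) s k"
    by (rule bracket_raise[OF h i(1-3)])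
  show thesis
  proof (rule that[OF jr(2), of j])
    show "j < n" using jr i by simp
    show "bvec m n q s k = bvec m n p s k" if "k < n" "(s, k) \<noteq> (r, j)" for s k
      using same that by (simp add: eq) (simp add: bvec_def)
    show "below m n (bvec m n p) (bvec m n q)"
      using below_raise[OF h i(1-3)] by (simp add: below_def eq) (simp add: bvec_def)
  qed
qed

lemma exists_rotation_below:
  assumes p: "p \<in> dyck_paths m n" and y: "brackets m n y" and le: "below m n (bvec m n p) y"
    and less: "r < m" "j < n" "bvec m n p r j < y r j"
  obtains q where "rotation m n p q" "below m n (bvec m n q) y"
proof -
  have h: "heights m n (height m p)" using heights_height[OF p] less by simp
  obtain i where i: "i < n" "0 < i" "height m p i < height m p (i - 1) + m"
      "below m n (bracket n (raise n (height m p) i)) y"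
    using exists_raise_below[OF h y] le less unfolding bvec_def by blast
  obtain q where q: "q \<in> dyck_paths m n" "\<And>j. j < n \<Longrightarrow> height m q j = raise n (height m p) i j"
    using height_surj[OF heights_raise[OF h i(1-3)]] by blast
  have "rotation m n p q"
    unfolding rotation_iff[OF p q(1)] using i q(2) by (intro bexI[of _ i]) auto
  moreover have "below m n (bvec m n q) y"
    using i(4) bracket_cong[of n "height m q" "raise n (height m p) i"] q(2)
    by (simp add: below_def bvec_def)
  ultimately show thesis by (rule that)
qed

lemma rotations_below: "(rotation m n)\<^sup>*\<^sup>* p q \<Longrightarrow> below m n (bvec m n p) (bvec m n q)"
proof (induction rule: rtranclp_induct)
  case base
  then show ?case by (rule below_refl)
next
  case (step q z)
  have "below m n (bvec m n q) (bvec m n z)" using step(2) by (rule rotation_bvec)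
  with step(3) show ?case by (rule below_trans)
qed

lemma rotation_neq:
  assumes "rotation m n p q"
  shows "p \<noteq> q"
proof
  assume eq: "p = q"
  have p: "p \<in> dyck_paths m n" using assms by (simp add: rotation_def)
  obtain i where i: "i < n" "height m p i = raise n (height m p) i i"
    using assms unfolding eq[symmetric] rotation_iff[OF p p] by auto
  then show False using bracket_ge[of i n "height m p" 0] by (simp add: raise_def)
qed

text \<open>As long as \<open>p \<noteq> q\<close>, some rotation of \<open>p\<close> stays below
  \<open>q\<close>. It strictly increases an entry, and entries are bounded by \<open>n\<close>, so
  the total deficit from \<open>n\<close> serves as the measure.\<close>

lemma below_rotations:
  assumes "p \<in> dyck_paths m n" "q \<in> dyck_paths m n" "below m n (bvec m n p) (bvec m n q)"
  shows "(rotation m n)\<^sup>*\<^sup>* p q"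
  using assms(1,3)
proof (induction "\<Sum>r<m. \<Sum>i<n. n - bvec m n p r i" arbitrary: p rule: less_induct)
  case less
  show ?case
  proof (cases "p = q")
    case True
    then show ?thesis by simp
  next
    case False
    then obtain r j where rj: "r < m" "j < n" "bvec m n p r j \<noteq> bvec m n q r j"
      using bvec_inj[OF less.prems(1) assms(2)] by blast
    then have "bvec m n p r j < bvec m n q r j" using less.prems by (simp add: below_def less_le)
    then obtain z where z: "rotation m n p z" "below m n (bvec m n z) (bvec m n q)"
      using exists_rotation_below[OF less.prems(1) brackets_bvec less.prems(2) rj(1,2)] by blast
    have zd: "z \<in> dyck_paths m n" using z(1) by (simp add: rotation_def)
    have le: "bvec m n p r i \<le> bvec m n z r i" if "r < m" "i < n" for r i
      using rotations_below[of m n p z] z(1) that by (auto simp: below_def)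
    obtain s k where sk: "s < m" "k < n" "bvec m n p s k \<noteq> bvec m n z s k"
      using bvec_inj[OF less.prems(1) zd] rotation_neq[OF z(1)] by blast
    have lt: "bvec m n p s k < bvec m n z s k" using sk le[of s k] by simp
    \<comment> \<open>Without this bound the truncated difference from \<open>n\<close> might not
      drop strictly.\<close>
    have "bvec m n p s k < n" using sk by (simp add: bvec_def bracket_less)
    then have "(\<Sum>i<n. n - bvec m n z s i) < (\<Sum>i<n. n - bvec m n p s i)"
      using le sk lt by (intro sum_strict_mono_ex1) (auto intro!: diff_le_mono2 bexI[of _ k])
    moreover have "(\<Sum>i<n. n - bvec m n z r i) \<le> (\<Sum>i<n. n - bvec m n p r i)" if "r < m" for r
      using le that by (intro sum_mono diff_le_mono2) simp
    ultimately have "(\<Sum>r<m. \<Sum>i<n. n - bvec m n z r i) < (\<Sum>r<m. \<Sum>i<n. n - bvec m n p r i)"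
      using sk by (intro sum_strict_mono_ex1) (auto intro!: bexI[of _ s])
    then have "(rotation m n)\<^sup>*\<^sup>* z q" using less.hyps zd z(2) by blast
    with z(1) show ?thesis by (rule converse_rtranclp_into_rtranclp)
  qed
qed

lemma carrier_tamari: "carrier (tamari m n) = dyck_paths m n"
  by (simp add: tamari_def)

lemma le_tamari_iff:
  assumes "p \<in> dyck_paths m n" "q \<in> dyck_paths m n"
  shows "p \<sqsubseteq>\<^bsub>tamari m n\<^esub> q \<longleftrightarrow> below m n (bvec m n p) (bvec m n q)"
  using below_rotations[OF assms] rotations_below[of m n p q] by (auto simp: tamari_def)

lemma partial_order_tamari: "partial_order (tamari m n)"
proof
  show "x \<sqsubseteq>\<^bsub>tamari m n\<^esub> z"
    if "x \<sqsubseteq>\<^bsub>tamari m n\<^esub> y" "y \<sqsubseteq>\<^bsub>tamari m n\<^esub> z" for x y z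
    using that by (simp add: tamari_def)
  show "x .=\<^bsub>tamari m n\<^esub> y"
    if "x \<sqsubseteq>\<^bsub>tamari m n\<^esub> y" "y \<sqsubseteq>\<^bsub>tamari m n\<^esub> x"
      "x \<in> carrier (tamari m n)" "y \<in> carrier (tamari m n)" for x y
    using that below_bvec_antisym[of x m n y] rotations_below[of m n]
    by (simp add: tamari_def)
qed (auto simp: tamari_def)

section \<open>Dense maps and the Dedekind--MacNeille completion\<close>

text \<open>Both structures are compared through labels in one transitive relation, so that
  \<open>C\<close> need not be embedded in \<open>L\<close>. In \<open>join_dense\<close> the label
  \<open>y\<close> is arbitrary because it is used for labels from either side.\<close>

lemma macneille_isomorphicI:
  fixes L :: "('a, 'd) gorder_scheme" and C :: "('b, 'e) gorder_scheme"
    and \<phi> :: "'a \<Rightarrow> 'c" and \<psi> :: "'b \<Rightarrow> 'c" and le :: "'c \<Rightarrow> 'c \<Rightarrow> bool"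
  assumes L: "partial_order L"
    and leL: "\<And>a b. a \<in> carrier L \<Longrightarrow> b \<in> carrier L \<Longrightarrow> a \<sqsubseteq>\<^bsub>L\<^esub> b \<longleftrightarrow> le (\<phi> a) (\<phi> b)"
    and leC: "\<And>c d. c \<in> carrier C \<Longrightarrow> d \<in> carrier C \<Longrightarrow> c \<sqsubseteq>\<^bsub>C\<^esub> d \<longleftrightarrow> le (\<psi> c) (\<psi> d)"
    and trans: "\<And>x y z. le x y \<Longrightarrow> le y z \<Longrightarrow> le x z"
    and join_dense: "\<And>a y. a \<in> carrier L \<Longrightarrow> \<not> le (\<phi> a) y \<Longrightarrow>
      \<exists>c\<in>carrier C. le (\<psi> c) (\<phi> a) \<and> \<not> le (\<psi> c) y"
    and meet_dense: "\<And>a c. a \<in> carrier L \<Longrightarrow> c \<in> carrier C \<Longrightarrow> \<not> le (\<psi> c) (\<phi> a) \<Longrightarrow>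
      \<exists>d\<in>carrier C. le (\<phi> a) (\<psi> d) \<and> \<not> le (\<psi> c) (\<psi> d)"
    and meets: "\<And>U. U \<subseteq> carrier C \<Longrightarrow>
      \<exists>a\<in>carrier L. \<forall>c\<in>carrier C. le (\<psi> c) (\<phi> a) \<longleftrightarrow> (\<forall>u\<in>U. le (\<psi> c) (\<psi> u))"
  shows "order_isomorphic L (macneille C)"
proof -
  define f where "f a = {c \<in> carrier C. le (\<psi> c) (\<phi> a)}" for a
  have upper: "Upper C A = {d \<in> carrier C. \<forall>c\<in>A. le (\<psi> c) (\<psi> d)}" if "A \<subseteq> carrier C" for A
    using that leC unfolding Upper_def by blast
  have lower: "Lower C A = {d \<in> carrier C. \<forall>c\<in>A. le (\<psi> d) (\<psi> c)}" if "A \<subseteq> carrier C" for A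
    using that leC unfolding Lower_def by blast
  have f_le: "f a \<subseteq> f b \<longleftrightarrow> le (\<phi> a) (\<phi> b)" if "a \<in> carrier L" for a b
    using join_dense[OF that, of "\<phi> b"] trans unfolding f_def by blast
  have closed: "Lower C (Upper C (f a)) = f a" if a: "a \<in> carrier L" for a
  proof -
    have "f a \<subseteq> carrier C" by (auto simp: f_def)
    \<comment> \<open>Join-density: an upper bound of the elements below \<open>a\<close> lies above
      \<open>a\<close>.\<close>
    then have "Upper C (f a) = {d \<in> carrier C. le (\<phi> a) (\<psi> d)}"
      unfolding upper[OF \<open>f a \<subseteq> carrier C\<close>] using join_dense[OF a] trans unfolding f_def by blast
    moreover have "\<dots> \<subseteq> carrier C" by auto
    ultimately have "Lower C (Upper C (f a)) =
        {c \<in> carrier C. \<forall>d\<in>{d \<in> carrier C. le (\<phi> a) (\<psi> d)}. le (\<psi> c) (\<psi> d)}"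
      using lower by simp
    \<comment> \<open>Meet-density: an element below everything that lies above \<open>a\<close> is
      below \<open>a\<close>.\<close>
    also have "\<dots> = f a" unfolding f_def using meet_dense[OF a] trans by blast
    finally show ?thesis .
  qed
  have "weak_partial_order (macneille C)"
    by unfold_locales (auto simp: macneille_def)
  moreover have "weak_partial_order L" using L by (simp add: partial_order_def)
  ultimately have emb: "order_emb L (macneille C) f"
    unfolding order_emb_def using f_le leL by (simp add: macneille_def)
  have "bij_betw f (carrier L) (carrier (macneille C))"
  proof (rule bij_betwI')
    fix a b assume ab: "a \<in> carrier L" "b \<in> carrier L"
    show "f a = f b \<longleftrightarrow> a = b"
    proof
      assume "f a = f b"
      then have "a \<sqsubseteq>\<^bsub>L\<^esub> b" "b \<sqsubseteq>\<^bsub>L\<^esub> a" using f_le[of a b] f_le[of b a] leL ab by auto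
      then show "a = b" using partial_order.le_antisym[OF L] ab by blast
    qed simp
  next
    fix a assume "a \<in> carrier L"
    then show "f a \<in> carrier (macneille C)" using closed by (auto simp: macneille_def f_def)
  next
    fix A assume "A \<in> carrier (macneille C)"
    then have A: "A \<subseteq> carrier C" "Lower C (Upper C A) = A" by (auto simp: macneille_def)
    have U: "Upper C A \<subseteq> carrier C" by (auto simp: Upper_def)
    then obtain a where a: "a \<in> carrier L"
      "\<forall>c\<in>carrier C. le (\<psi> c) (\<phi> a) \<longleftrightarrow> (\<forall>u\<in>Upper C A. le (\<psi> c) (\<psi> u))"
      using meets by blast
    \<comment> \<open>The meet of all upper bounds of a cut has exactly the cut below it.\<close>
    have "A = f a" using A(2) lower[OF U] a(2) unfolding f_def by auto
    with a(1) show "\<exists>a\<in>carrier L. A = f a" by blast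
  qed
  with emb show ?thesis unfolding order_isomorphic_def by blast
qed

section \<open>The cover poset of the Tamari lattice\<close>

text \<open>All clauses pass to pointwise infima; for the last one, \<open>j \<le> x r i\<close>
  puts \<open>j\<close> inside the bracket in every member of the family.\<close>

lemma brackets_Inf:
  assumes "0 < n" and y: "\<And>u. u \<in> U \<Longrightarrow> brackets m n (y u)"
  obtains x where "brackets m n x"
    "\<And>z. brackets m n z \<Longrightarrow> below m n z x \<longleftrightarrow> (\<forall>u\<in>U. below m n z (y u))"
proof -
  \<comment> \<open>Inserting \<open>n - 1\<close>, the largest possible entry, keeps the set
    nonempty and yields the top vector for empty \<open>U\<close>.\<close>
  define x where "x r i = Inf (insert (n - 1) ((\<lambda>u. y u r i) ` U))" for r i
  have le_x: "k \<le> x r i \<longleftrightarrow> k \<le> n - 1 \<and> (\<forall>u\<in>U. k \<le> y u r i)" for k r i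
    unfolding x_def by (subst le_cInf_iff) auto
  have y1: "i \<le> y u r i" "y u r i < n" if "u \<in> U" "r < m" "i < n" for u r i
    using y that unfolding brackets_def by auto
  have y2: "y u r i \<le> y u s i" if "u \<in> U" "s \<le> r" "r < m" "i < n" for u r s i
    using y that unfolding brackets_def by auto
  have y3: "y u 0 j \<le> y u r i" if "u \<in> U" "i < j" "j < n" "j \<le> y u r i" "r < m" for u r i j
    using y that unfolding brackets_def by auto
  have x_le: "x r i \<le> n - 1" "u \<in> U \<Longrightarrow> x r i \<le> y u r i" for r i u
    using le_x[of "x r i" r i] by auto
  have "brackets m n x"
    unfolding brackets_def
  proof (intro conjI allI impI)
    fix r i assume "r < m" "i < n"
    then show "i \<le> x r i" "x r i < n" using x_le(1)[of r i] y1 by (auto simp: le_x)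
    fix s assume "s \<le> r"
    show "x r i \<le> x s i"
      unfolding le_x[of "x r i" s i]
    proof (intro conjI ballI)
      show "x r i \<le> n - 1" by (rule x_le)
      fix u assume u: "u \<in> U"
      show "x r i \<le> y u s i"
        using x_le(2)[OF u, of r i] y2[OF u \<open>s \<le> r\<close> \<open>r < m\<close> \<open>i < n\<close>] by simp
    qed
  next
    fix r i j assume a: "r < m" "i < j" "j < n" "j \<le> x r i"
    have "x 0 j \<le> y u r i" if "u \<in> U" for u
      using x_le(2)[OF that, of 0 j] y3[OF that a(2,3) _ a(1)] a(4) le_x[of j r i] that
      by (meson le_trans)
    then show "x 0 j \<le> x r i" unfolding le_x[of "x 0 j" r i] using x_le(1) by blast
  qed
  moreover have "below m n z x \<longleftrightarrow> (\<forall>u\<in>U. below m n z (y u))" if "brackets m n z" for z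
  proof -
    have "z r i \<le> n - 1" if "r < m" "i < n" for r i
      using \<open>brackets m n z\<close> that unfolding brackets_def by fastforce
    then show ?thesis unfolding below_def le_x by blast
  qed
  ultimately show thesis by (rule that)
qed

context
  notes One_nat_def [simp del]
begin

section \<open>The ordinary Tamari lattice and its covers\<close>

lemma eq_tamari: "eq (tamari m n) = (=)"
  by (simp add: tamari_def)

lemma tamari_1_le_iff:
  assumes "p \<in> dyck_paths 1 n" "q \<in> dyck_paths 1 n"
  shows "p \<sqsubseteq>\<^bsub>tamari 1 n\<^esub> q \<longleftrightarrow> (\<forall>i<n. bvec 1 n p 0 i \<le> bvec 1 n q 0 i)"
  using le_tamari_iff[OF assms] by (simp add: below_def)

lemma bvec_1_surj:
  assumes "\<And>i. i < n \<Longrightarrow> i \<le> x i \<and> x i < n"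
    and "\<And>i j. i < j \<Longrightarrow> j < n \<Longrightarrow> j \<le> x i \<Longrightarrow> x j \<le> x i"
  obtains p where "p \<in> dyck_paths 1 n" "\<And>i. i < n \<Longrightarrow> bvec 1 n p 0 i = x i"
proof -
  have "brackets 1 n (\<lambda>r. x)" using assms by (simp add: brackets_def)
  then obtain p where "p \<in> dyck_paths 1 n" "\<And>r i. r < 1 \<Longrightarrow> i < n \<Longrightarrow> bvec 1 n p r i = x i"
    using bvec_surj by blast
  then show thesis using that by simp
qed

lemma bvec_ge: "i < n \<Longrightarrow> i \<le> bvec m n p r i"
  and bvec_less: "i < n \<Longrightarrow> bvec m n p r i < n"
  by (simp_all add: bvec_def bracket_ge bracket_less)

lemma bvec_1_nested:
  "i < j \<Longrightarrow> j < n \<Longrightarrow> j \<le> bvec 1 n p 0 i \<Longrightarrow> bvec 1 n p 0 j \<le> bvec 1 n p 0 i"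
  using brackets_bvec[of 1 n p] by (simp add: brackets_def)

text \<open>\<open>\<bottom>\<close> is a choice among least elements, so one has to be exhibited:
  the vector with entry \<open>i\<close> at each \<open>i\<close>, the smallest value
  allowed.\<close>

lemma tamari_1_bottom:
  shows bottom_dyck_path: "\<bottom>\<^bsub>tamari 1 n\<^esub> \<in> dyck_paths 1 n"
    and bvec_bottom: "\<And>i. i < n \<Longrightarrow> bvec 1 n \<bottom>\<^bsub>tamari 1 n\<^esub> 0 i = i"
proof -
  obtain p where p: "p \<in> dyck_paths 1 n" "\<And>i. i < n \<Longrightarrow> bvec 1 n p 0 i = i"
    using bvec_1_surj[of n "\<lambda>i. i"] by auto
  have "least (tamari 1 n) p (carrier (tamari 1 n))"
    unfolding least_def carrier_tamari
    using p tamari_1_le_iff[OF p(1)] by (simp add: bvec_ge)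
  then have b: "least (tamari 1 n) \<bottom>\<^bsub>tamari 1 n\<^esub> (carrier (tamari 1 n))"
    unfolding bottom_def by (rule someI)
  then show b1: "\<bottom>\<^bsub>tamari 1 n\<^esub> \<in> dyck_paths 1 n" by (simp add: least_def carrier_tamari)
  have "\<bottom>\<^bsub>tamari 1 n\<^esub> \<sqsubseteq>\<^bsub>tamari 1 n\<^esub> p" using b p by (simp add: least_def carrier_tamari)
  then show "bvec 1 n \<bottom>\<^bsub>tamari 1 n\<^esub> 0 i = i" if "i < n" for i
    using tamari_1_le_iff[OF b1 p(1)] p(2) bvec_ge that by (metis antisym)
qed

text \<open>The first rotation on a way from \<open>p\<close> to \<open>q\<close> already reaches
  \<open>q\<close>, and a rotation changes one entry.\<close>

lemma covered_by_bvec: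
  assumes "covered_by (tamari 1 n) p q"
  obtains j where "\<And>k. k < n \<Longrightarrow> k \<noteq> j \<Longrightarrow> bvec 1 n q 0 k = bvec 1 n p 0 k"
proof -
  have pq: "p \<in> dyck_paths 1 n" "q \<in> dyck_paths 1 n" "(rotation 1 n)\<^sup>*\<^sup>* p q" "p \<noteq> q"
    and min: "\<And>z. z \<in> dyck_paths 1 n \<Longrightarrow> (rotation 1 n)\<^sup>*\<^sup>* p z \<Longrightarrow> (rotation 1 n)\<^sup>*\<^sup>* z q \<Longrightarrow>
      p = z \<or> z = q"
    using assms by (auto simp: covered_by_def tamari_def lless_def)
  obtain z where z: "rotation 1 n p z" "(rotation 1 n)\<^sup>*\<^sup>* z q"
    using pq(3,4) by (meson converse_rtranclpE)
  have "z = q"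
    using min[of z] r_into_rtranclp[of "rotation 1 n", OF z(1)] z rotation_neq[OF z(1)]
    by (auto simp: rotation_def)
  then obtain j r where jr: "r < 1"
    "\<And>s k. k < n \<Longrightarrow> (s, k) \<noteq> (r, j) \<Longrightarrow> bvec 1 n q s k = bvec 1 n p s k"
    using rotation_bvec[OF z(1)] by metis
  show thesis by (rule that[of j]) (use jr in simp)
qed

text \<open>Bracket vectors decrease in \<open>r\<close> whereas chains increase, so the chain is read backwards.\<close>

definition chain_bvec :: "nat \<Rightarrow> lattice_step list list \<Rightarrow> nat \<Rightarrow> nat \<Rightarrow> nat" where
  "chain_bvec n xs r = bvec 1 n (xs ! (length xs - Suc r)) 0"

lemma carrier_cover_poset_iff:
  "xs \<in> carrier (cover_poset m P) \<longleftrightarrow>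
     length xs = m \<and> set xs \<subseteq> carrier P \<and> sorted_wrt (\<sqsubseteq>\<^bsub>P\<^esub>) xs \<and>
     (set xs - {\<bottom>\<^bsub>P\<^esub>} = {} \<or> (\<exists>p. set xs - {\<bottom>\<^bsub>P\<^esub>} = {p}) \<or>
      (\<exists>p q. set xs - {\<bottom>\<^bsub>P\<^esub>} = {p, q} \<and> covered_by P p q))"
  by (simp add: cover_poset_def)

lemma le_cover_poset_iff:
  assumes "xs \<in> carrier (cover_poset m (tamari 1 n))" "ys \<in> carrier (cover_poset m (tamari 1 n))"
  shows "xs \<sqsubseteq>\<^bsub>cover_poset m (tamari 1 n)\<^esub> ys \<longleftrightarrow> below m n (chain_bvec n xs) (chain_bvec n ys)"
proof -
  have len: "length xs = m" "length ys = m"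
    and sub: "set xs \<subseteq> dyck_paths 1 n" "set ys \<subseteq> dyck_paths 1 n"
    using assms by (auto simp: carrier_cover_poset_iff carrier_tamari)
  let ?P = "\<lambda>k. \<forall>i<n. bvec 1 n (xs ! k) 0 i \<le> bvec 1 n (ys ! k) 0 i"
  have "xs ! k \<sqsubseteq>\<^bsub>tamari 1 n\<^esub> ys ! k \<longleftrightarrow> ?P k" if "k < m" for k
    using sub len that by (intro tamari_1_le_iff) (auto simp: subset_iff)
  then have "xs \<sqsubseteq>\<^bsub>cover_poset m (tamari 1 n)\<^esub> ys \<longleftrightarrow> (\<forall>k<m. ?P k)"
    by (simp add: cover_poset_def list_all2_conv_all_nth len)
  also have "\<dots> \<longleftrightarrow> (\<forall>r<m. ?P (m - Suc r))"
  proof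
    assume a: "\<forall>r<m. ?P (m - Suc r)"
    show "\<forall>k<m. ?P k"
    proof (intro allI impI)
      fix k i assume "k < m" "i < n"
      then have "m - Suc (m - Suc k) = k" "m - Suc k < m" by auto
      then show "bvec 1 n (xs ! k) 0 i \<le> bvec 1 n (ys ! k) 0 i"
        using a \<open>i < n\<close> by metis
    qed
  qed simp
  finally show ?thesis by (simp add: below_def chain_bvec_def len)
qed

text \<open>Only the coupling of the largest member \<open>y 0\<close> with another member
  \<open>y r\<close> needs an argument. If \<open>y 0\<close> is least, its entry at
  \<open>j\<close> is just \<open>j\<close>; if \<open>y r\<close> is least, no \<open>j > i\<close>
  lies in its bracket at \<open>i\<close>; two equal members reduce to ordinary nesting. What
  remains is a cover.\<close>

lemma brackets_chain_bvec:
  assumes "xs \<in> carrier (cover_poset m (tamari 1 n))"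
  shows "brackets m n (chain_bvec n xs)"
proof -
  let ?b = "\<bottom>\<^bsub>tamari 1 n\<^esub>"
  have len: "length xs = m" and sub: "set xs \<subseteq> dyck_paths 1 n"
    and sorted: "sorted_wrt (\<sqsubseteq>\<^bsub>tamari 1 n\<^esub>) xs"
    and vals: "set xs - {?b} = {} \<or> (\<exists>p. set xs - {?b} = {p}) \<or>
      (\<exists>p q. set xs - {?b} = {p, q} \<and> covered_by (tamari 1 n) p q)"
    using assms by (auto simp: carrier_cover_poset_iff carrier_tamari)
  define y where "y r = xs ! (m - Suc r)" for r
  have y: "y r \<in> set xs" "y r \<in> dyck_paths 1 n" if "r < m" for r
    using sub that len by (auto simp: y_def subset_iff)
  have mono: "bvec 1 n (y r) 0 i \<le> bvec 1 n (y s) 0 i" if "s \<le> r" "r < m" "i < n" for r s i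
  proof (cases "s = r")
    case False
    then have "y r \<sqsubseteq>\<^bsub>tamari 1 n\<^esub> y s"
      unfolding y_def by (intro sorted_wrt_nth_less[OF sorted]) (use that len in auto)
    then show ?thesis using tamari_1_le_iff y that by auto
  qed simp
  have cross: "bvec 1 n (y 0) 0 j \<le> bvec 1 n (y r) 0 i"
    if a: "r < m" "i < j" "j < n" "j \<le> bvec 1 n (y r) 0 i" for r i j
  proof -
    have m: "0 < m" using a by simp
    have nested: "bvec 1 n (y r) 0 j \<le> bvec 1 n (y r) 0 i"
      using bvec_1_nested[OF a(2-4)] .
    consider "y 0 = ?b" | "y r = ?b" | "y r = y 0"
      | p q where "{p, q} = {y 0, y r}" "y r \<noteq> y 0" "covered_by (tamari 1 n) p q"
    proof -
      have "\<exists>p q. {p, q} = {y 0, y r} \<and> covered_by (tamari 1 n) p q"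
        if ne: "y 0 \<noteq> ?b" "y r \<noteq> ?b" "y r \<noteq> y 0"
      proof -
        have "{y 0, y r} \<subseteq> set xs - {?b}" using y m a ne by simp
        with vals show ?thesis
        proof (elim disjE exE conjE)
          fix p q assume *: "set xs - {?b} = {p, q}" "covered_by (tamari 1 n) p q"
          then have "{y 0, y r} \<subseteq> {p, q}" using \<open>{y 0, y r} \<subseteq> set xs - {?b}\<close> by simp
          then have "{p, q} = {y 0, y r}" using ne by auto
          with *(2) show ?thesis by blast
        qed (use ne in auto)
      qed
      then show thesis using that by blast
    qed
    then show ?thesis
    proof cases
      case 1
      then show ?thesis using bvec_bottom a by simp
    next
      case 2
      then show ?thesis using bvec_bottom a by simp
    next
      case 3
      then show ?thesis using nested by simp
    next
      case (4 p q)
      then obtain k where k: "\<And>l. l < n \<Longrightarrow> l \<noteq> k \<Longrightarrow> bvec 1 n q 0 l = bvec 1 n p 0 l"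
        using covered_by_bvec by blast
      then have k': "bvec 1 n (y 0) 0 l = bvec 1 n (y r) 0 l" if "l < n" "l \<noteq> k" for l
        using 4 that by (auto simp: doubleton_eq_iff)
      \<comment> \<open>As \<open>i \<noteq> j\<close>, the two paths agree at \<open>j\<close> or
        at \<open>i\<close>, and nesting in \<open>y r\<close> or in \<open>y 0\<close>,
        respectively, applies.\<close>
      show ?thesis
      proof (cases "i = k")
        case True
        then show ?thesis using k'[of j] nested a by simp
      next
        case False
        then show ?thesis using k'[of i] bvec_1_nested[of i j n "y 0"] a by simp
      qed
    qed
  qed
  have "chain_bvec n xs r = bvec 1 n (y r) 0" for r
    by (simp add: chain_bvec_def y_def len)
  then show ?thesis
    unfolding brackets_def using mono cross by (simp add: bvec_ge bvec_less)
qed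

section \<open>Separating chains\<close>

text \<open>Put \<open>m - t\<close> copies of \<open>a\<close> before \<open>t\<close> copies of
  \<open>b\<close>; read backwards, \<open>b\<close> fills the layers below
  \<open>t\<close>.\<close>

lemma two_valued_chain:
  assumes a: "a \<in> dyck_paths 1 n" and b: "b \<in> dyck_paths 1 n"
    and ab: "\<And>i. i < n \<Longrightarrow> bvec 1 n a 0 i \<le> bvec 1 n b 0 i"
    and cov: "a = \<bottom>\<^bsub>tamari 1 n\<^esub> \<or> covered_by (tamari 1 n) a b" and "t \<le> m"
  obtains c where "c \<in> carrier (cover_poset m (tamari 1 n))"
    "\<And>r i. r < m \<Longrightarrow> chain_bvec n c r i = (if r < t then bvec 1 n b 0 i else bvec 1 n a 0 i)"
proof -
  define c where "c = map (\<lambda>k. if k < m - t then a else b) [0..<m]"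
  have le: "p \<sqsubseteq>\<^bsub>tamari 1 n\<^esub> p" if "p \<in> dyck_paths 1 n" for p
    using that by (simp add: tamari_1_le_iff)
  have "a \<sqsubseteq>\<^bsub>tamari 1 n\<^esub> b" using ab tamari_1_le_iff[OF a b] by simp
  then have sorted: "sorted_wrt (\<sqsubseteq>\<^bsub>tamari 1 n\<^esub>) c"
    using le a b by (auto simp: sorted_wrt_iff_nth_less c_def)
  have "set c \<subseteq> {a, b}" by (auto simp: c_def)
  then have "set c - {\<bottom>\<^bsub>tamari 1 n\<^esub>} \<in> {{}, {a}, {b}, {a, b}}" by blast
  \<comment> \<open>The other alternative in \<open>cov\<close> cannot occur here, since the least
    element has been removed.\<close>
  moreover have "covered_by (tamari 1 n) a b" if "set c - {\<bottom>\<^bsub>tamari 1 n\<^esub>} = {a, b}"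
    using cov that by blast
  ultimately have "set c - {\<bottom>\<^bsub>tamari 1 n\<^esub>} = {} \<or> (\<exists>p. set c - {\<bottom>\<^bsub>tamari 1 n\<^esub>} = {p}) \<or>
      (\<exists>p q. set c - {\<bottom>\<^bsub>tamari 1 n\<^esub>} = {p, q} \<and> covered_by (tamari 1 n) p q)"
    by blast
  then have "c \<in> carrier (cover_poset m (tamari 1 n))"
    using sorted \<open>set c \<subseteq> {a, b}\<close> a b unfolding carrier_cover_poset_iff carrier_tamari
    by (auto simp: c_def)
  moreover have "chain_bvec n c r i = (if r < t then bvec 1 n b 0 i else bvec 1 n a 0 i)"
    if "r < m" for r i
    using that \<open>t \<le> m\<close> by (auto simp: chain_bvec_def c_def)
  ultimately show thesis by (rule that)
qed

text \<open>A join-irreducible of the Tamari lattice, preceded by copies of the least element.\<close>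

lemma chain_bvecs_join_dense:
  assumes y: "brackets m n y" and "\<not> below m n y x"
  obtains c where "c \<in> carrier (cover_poset m (tamari 1 n))"
    "below m n (chain_bvec n c) y" "\<not> below m n (chain_bvec n c) x"
proof -
  obtain s i where si: "s < m" "i < n" "x s i < y s i"
    using assms(2) by (auto simp: below_def not_le)
  have y1: "\<And>r i. r < m \<Longrightarrow> i < n \<Longrightarrow> i \<le> y r i \<and> y r i < n"
    and y2: "\<And>r s i. s \<le> r \<Longrightarrow> r < m \<Longrightarrow> i < n \<Longrightarrow> y r i \<le> y s i"
    using y unfolding brackets_def by auto
  \<comment> \<open>The smallest bracket vector with entry \<open>y s i\<close> at \<open>i\<close>.
    It fills the layers up to and including \<open>s\<close>, where
    \<open>y r i \<ge> y s i\<close>; hence \<open>Suc s\<close> copies below.\<close>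
  let ?x = "\<lambda>k. if k = i then y s i else k"
  have "k \<le> ?x k \<and> ?x k < n" if "k < n" for k using that y1[OF si(1,2)] by simp
  moreover have "?x l \<le> ?x k" if "k < l" "l < n" "l \<le> ?x k" for k l
    using that by (auto split: if_splits)
  ultimately obtain p where p: "p \<in> dyck_paths 1 n" "\<And>k. k < n \<Longrightarrow> bvec 1 n p 0 k = ?x k"
    using bvec_1_surj[of n ?x] by blast
  have "bvec 1 n \<bottom>\<^bsub>tamari 1 n\<^esub> 0 k \<le> bvec 1 n p 0 k" if "k < n" for k
    using that by (simp add: bvec_bottom bvec_ge)
  then obtain c where c: "c \<in> carrier (cover_poset m (tamari 1 n))"
    "\<And>r k. r < m \<Longrightarrow> chain_bvec n c r k =
      (if r < Suc s then bvec 1 n p 0 k else bvec 1 n \<bottom>\<^bsub>tamari 1 n\<^esub> 0 k)"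
    using two_valued_chain[OF bottom_dyck_path p(1), of "Suc s" m] si(1) by auto
  show thesis
  proof (rule that[OF c(1)])
    show "below m n (chain_bvec n c) y"
      unfolding below_def
    proof (intro allI impI)
      fix r k assume rk: "r < m" "k < n"
      show "chain_bvec n c r k \<le> y r k"
        using y1[OF rk] y2[of r s i] si rk p(2)[OF rk(2)] bvec_bottom[OF rk(2)] c(2)[OF rk(1), of k]
        by auto
    qed
    have "chain_bvec n c s i = y s i" using c(2)[OF si(1)] p(2)[OF si(2)] by simp
    then show "\<not> below m n (chain_bvec n c) x" using si by (metis below_def not_le)
  qed
qed

text \<open>
  Copies of a meet-irreducible of the Tamari lattice, followed by copies of its unique upper cover.
\<close>

lemma chain_bvecs_meet_dense:
  assumes x: "brackets m n x" and y: "brackets m n y" and "\<not> below m n y x"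
  obtains c where "c \<in> carrier (cover_poset m (tamari 1 n))"
    "below m n x (chain_bvec n c)" "\<not> below m n y (chain_bvec n c)"
proof -
  obtain s i where si: "s < m" "i < n" "x s i < y s i"
    using assms(3) by (auto simp: below_def not_le)
  have x1: "\<And>r i. r < m \<Longrightarrow> i < n \<Longrightarrow> i \<le> x r i \<and> x r i < n"
    and x2: "\<And>r s i. s \<le> r \<Longrightarrow> r < m \<Longrightarrow> i < n \<Longrightarrow> x r i \<le> x s i"
    and x3: "\<And>r i j. i < j \<Longrightarrow> j < n \<Longrightarrow> j \<le> x r i \<Longrightarrow> r < m \<Longrightarrow> x 0 j \<le> x r i"
    using x unfolding brackets_def by auto
  define e where "e = x s i"
  have "y s i < n" using y si by (auto simp: brackets_def)
  then have e: "i \<le> e" "Suc e < n" using x1[OF si(1,2)] si(3) by (auto simp: e_def)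
  \<comment> \<open>\<open>?p\<close> is the largest bracket vector whose entry at \<open>i\<close>
    is \<open>e\<close>: nesting caps the entries from \<open>i\<close> to \<open>e\<close>, all
    others are maximal. \<open>?q\<close> lifts the cap at \<open>i\<close> alone.\<close>
  let ?p = "\<lambda>k. if i \<le> k \<and> k \<le> e then e else n - 1"
  let ?q = "\<lambda>k. if i < k \<and> k \<le> e then e else n - 1"
  have "k \<le> ?p k \<and> ?p k < n" if "k < n" for k using that e by auto
  moreover have "?p l \<le> ?p k" if "k < l" "l < n" "l \<le> ?p k" for k l
    using that e by (auto split: if_splits)
  ultimately obtain p where p: "p \<in> dyck_paths 1 n" "\<And>k. k < n \<Longrightarrow> bvec 1 n p 0 k = ?p k"
    using bvec_1_surj[of n ?p] by blast
  have "k \<le> ?q k \<and> ?q k < n" if "k < n" for k using that e by auto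
  moreover have "?q l \<le> ?q k" if "k < l" "l < n" "l \<le> ?q k" for k l
    using that e by (auto split: if_splits)
  ultimately obtain q where q: "q \<in> dyck_paths 1 n" "\<And>k. k < n \<Longrightarrow> bvec 1 n q 0 k = ?q k"
    using bvec_1_surj[of n ?q] by blast
  have pq: "bvec 1 n p 0 k \<le> bvec 1 n q 0 k" if "k < n" for k
    using e that by (auto simp: p(2) q(2))
  have "p \<noteq> q" using p(2)[of i] q(2)[of i] e by auto
  moreover have "z = p \<or> z = q" if z: "z \<in> dyck_paths 1 n"
    and le: "\<And>k. k < n \<Longrightarrow> bvec 1 n p 0 k \<le> bvec 1 n z 0 k"
      "\<And>k. k < n \<Longrightarrow> bvec 1 n z 0 k \<le> bvec 1 n q 0 k" for z
  proof -
    have ne: "bvec 1 n z 0 k = ?p k" "bvec 1 n z 0 k = ?q k" if "k < n" "k \<noteq> i" for k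
      using le[of k] p(2)[of k] q(2)[of k] that by (auto split: if_splits)
    \<comment> \<open>Both \<open>p\<close> and \<open>q\<close> have entry \<open>n - 1\<close> at
      \<open>Suc e\<close>, so a bracket at \<open>i\<close> that reaches \<open>Suc e\<close> is
      forced by nesting to extend to \<open>n - 1\<close>.\<close>
    have "bvec 1 n z 0 i = e \<or> bvec 1 n z 0 i = n - 1"
    proof (cases "Suc e \<le> bvec 1 n z 0 i")
      case True
      then have "bvec 1 n z 0 (Suc e) \<le> bvec 1 n z 0 i"
        using bvec_1_nested[of i "Suc e" n z] e by simp
      then show ?thesis using ne[of "Suc e"] bvec_less[of i n 1 z 0] e by auto
    next
      case False
      then show ?thesis using le(1)[of i] p(2)[of i] e by auto
    qed
    then show ?thesis
    proof
      assume i: "bvec 1 n z 0 i = e"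
      have "z = p"
      proof (rule bvec_inj[OF z p(1)])
        show "bvec 1 n z r k = bvec 1 n p r k" if "r < 1" "k < n" for r k
          using that i e ne(1)[of k] p(2)[of k] by (cases "k = i") auto
      qed
      then show ?thesis ..
    next
      assume i: "bvec 1 n z 0 i = n - 1"
      have "z = q"
      proof (rule bvec_inj[OF z q(1)])
        show "bvec 1 n z r k = bvec 1 n q r k" if "r < 1" "k < n" for r k
          using that i e ne(2)[of k] q(2)[of k] by (cases "k = i") auto
      qed
      then show ?thesis ..
    qed
  qed
  then have "z = p \<or> z = q" if "z \<in> dyck_paths 1 n"
    "p \<sqsubseteq>\<^bsub>tamari 1 n\<^esub> z" "z \<sqsubseteq>\<^bsub>tamari 1 n\<^esub> q" for z
    using that p(1) q(1) tamari_1_le_iff by blast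
  ultimately have "covered_by (tamari 1 n) p q"
    unfolding covered_by_def carrier_tamari lless_def eq_tamari
    using p(1) q(1) tamari_1_le_iff[OF p(1) q(1)] pq by blast
  then obtain c where c: "c \<in> carrier (cover_poset m (tamari 1 n))"
    "\<And>r k. r < m \<Longrightarrow> chain_bvec n c r k = (if r < s then bvec 1 n q 0 k else bvec 1 n p 0 k)"
    using two_valued_chain[OF p(1) q(1) pq, of s m] si(1) by auto
  show thesis
  proof (rule that[OF c(1)])
    show "below m n x (chain_bvec n c)"
      unfolding below_def
    proof (intro allI impI)
      fix r k assume rk: "r < m" "k < n"
      \<comment> \<open>Compatibility caps layer 0, hence every layer, at positions inside the
        bracket \<open>(s, i)\<close>. At \<open>i\<close> itself the cap holds for
        \<open>r \<ge> s\<close> only, so the layers below \<open>s\<close> take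
        \<open>q\<close>.\<close>
      have "x r k \<le> e" if "i < k" "k \<le> e"
        using x3[of i k s] x2[of 0 r k] that si rk by (simp add: e_def)
      moreover have "x r i \<le> e" if "s \<le> r" using x2[of s r i] that si rk by (simp add: e_def)
      moreover have "x r k \<le> n - 1" using x1[OF rk] by linarith
      ultimately show "x r k \<le> chain_bvec n c r k"
        using c(2)[OF rk(1), of k] p(2)[OF rk(2)] q(2)[OF rk(2)] by (cases "k = i") auto
    qed
    have "chain_bvec n c s i = e" using c(2)[OF si(1)] p(2)[OF si(2)] e by simp
    then show "\<not> below m n y (chain_bvec n c)" using si by (metis below_def not_le e_def)
  qed
qed

end

theorem theorem1p4:
  fixes m n :: nat
  assumes "m > 0" and "n > 0"
  shows "order_isomorphic (tamari m n) (macneille (cover_poset m (tamari 1 n)))"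
proof (rule macneille_isomorphicI[where \<phi> = "bvec m n" and \<psi> = "chain_bvec n" and le = "below m n"])
  show "partial_order (tamari m n)" by (rule partial_order_tamari)
  show "a \<sqsubseteq>\<^bsub>tamari m n\<^esub> b \<longleftrightarrow> below m n (bvec m n a) (bvec m n b)"
    if "a \<in> carrier (tamari m n)" "b \<in> carrier (tamari m n)" for a b
    using that le_tamari_iff by (simp add: carrier_tamari)
  show "\<exists>c\<in>carrier (cover_poset m (tamari 1 n)).
      below m n (chain_bvec n c) (bvec m n a) \<and> \<not> below m n (chain_bvec n c) y"
    if "\<not> below m n (bvec m n a) y" for a y
    using chain_bvecs_join_dense[OF brackets_bvec that] by blast
  show "\<exists>d\<in>carrier (cover_poset m (tamari 1 n)).
      below m n (bvec m n a) (chain_bvec n d) \<and> \<not> below m n (chain_bvec n c) (chain_bvec n d)"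
    if "c \<in> carrier (cover_poset m (tamari 1 n))" "\<not> below m n (chain_bvec n c) (bvec m n a)"
    for a c
    using chain_bvecs_meet_dense[OF brackets_bvec brackets_chain_bvec[OF that(1)] that(2)] by blast
  show "\<exists>a\<in>carrier (tamari m n). \<forall>c\<in>carrier (cover_poset m (tamari 1 n)).
      below m n (chain_bvec n c) (bvec m n a) \<longleftrightarrow>
      (\<forall>u\<in>U. below m n (chain_bvec n c) (chain_bvec n u))"
    if U: "U \<subseteq> carrier (cover_poset m (tamari 1 n))" for U
  proof -
    \<comment> \<open>The infimum is only known to satisfy \<open>brackets\<close>; realising it by
      a path turns it into an element of \<open>tamari m n\<close>.\<close>
    obtain x where x: "brackets m n x" "\<And>z. brackets m n z \<Longrightarrow>
        below m n z x \<longleftrightarrow> (\<forall>u\<in>U. below m n z (chain_bvec n u))"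
      using brackets_Inf[OF \<open>n > 0\<close>, of U m "chain_bvec n"] U brackets_chain_bvec by blast
    obtain a where a: "a \<in> dyck_paths m n" "\<And>r i. r < m \<Longrightarrow> i < n \<Longrightarrow> bvec m n a r i = x r i"
      using bvec_surj[OF x(1)] by blast
    have "below m n z (bvec m n a) \<longleftrightarrow> below m n z x" for z
      using a(2) by (simp add: below_def)
    then have "\<forall>c\<in>carrier (cover_poset m (tamari 1 n)). below m n (chain_bvec n c) (bvec m n a) \<longleftrightarrow>
        (\<forall>u\<in>U. below m n (chain_bvec n c) (chain_bvec n u))"
      using x(2) brackets_chain_bvec by blast
    with a(1) show ?thesis unfolding carrier_tamari by (rule bexI[rotated])
  qed
qed (fact le_cover_poset_iff below_trans)+

end
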